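(* There are universal constants $c>0$ and $d_0$ such that the following holds for every $d_x\ge d_0$. Let $\mathcal A$ be any deterministic black-box control algorithm. Then there exist a stabilizable system with state dimension $d_x$ that is also $(1,1)$-strongly controllable, and a sequence of oblivious perturbations and convex costs, such that with $x_1=e_1$ and $T=d_x$, $$\mathrm{Regret}_T(\mathcal A)\ge 2^{c\mathcal L},$$ where $\mathcal L$ is the size of the instance.
   Context: The system is $x_{t+1}=Ax_t+Bu_t+w_t$ with $x_t\in\mathbb R^{d_x}$, $u_t\in\mathbb R^{d_u}$; oblivious means that the perturbations $w_t$ and costs $c_t(x,u)$ are fixed in advance; perturbations satisfy $\|w_t\|\le1$. A deterministic black-box control algorithm, not knowing $A,B$, outputs $u_t=\mathcal A(x_1,\dots,x_t,c_1,\dots,c_t)$ (a deterministic function). $e_1$ is the first standard basis vector. $(A,B)$ is $(k,\kappa)$-strongly controllable if $C_k=[B\ AB\cdots A^{k-1}B]$ has full row rank and $\|(C_kC_k^\top)^{-1}\|\le\kappa$ (spectral norm). Stabilizable means there is $K$ with $A+BK$ of spectral radius less than $1$. Size: $\mathcal L=kd_u+d_x+G+\beta+\kappa$, where here $k=\kappa=1$, $\beta\ge1$ is an upper bound on $\|A\|,\|B\|$, and $G$ is such that for all $D$, $\|\nabla_{(x,u)}c_t(x,u)\|\le GD$ whenever $\|x\|,\|u\|\le D$. Regret: $J_T(\mathcal A)=\sum_{t=1}^Tc_t(x_t^{\mathcal A},u_t^{\mathcal A})$ and $\mathrm{Regret}_T(\mathcal A)=J_T(\mathcal A)-\min_{\pi\in\Pi}J_T(\pi)$,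 where $\Pi$ is the class of disturbance-action controllers $u_t=Kx_t+\sum_{i=1}^HM^{i-1}w_{t-i}$ (with $w_s=0$ for $s\le0$), run on the same perturbations and costs. *)

theory Defs
  imports Complex_Main "Jordan_Normal_Form.Spectral_Radius" "Jordan_Normal_Form.DL_Rank"
    "Jordan_Normal_Form.Gauss_Jordan_Elimination"
begin

section \<open>Euclidean norm and spectral norm\<close>

definition vnorm :: "real vec \<Rightarrow> real" where
  "vnorm v = sqrt (v \<bullet> v)"

definition spectral_norm :: "real mat \<Rightarrow> real" where
  "spectral_norm A = (SUP v \<in> {v \<in> carrier_vec (dim_col A). vnorm v \<le> 1}. vnorm (A *\<^sub>v v))"

section \<open>Systems\<close>

definition stabilizable :: "nat \<Rightarrow> nat \<Rightarrow> real mat \<Rightarrow> real mat \<Rightarrow> bool" where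
  "stabilizable dx du A B \<longleftrightarrow>
     (\<exists>K \<in> carrier_mat du dx. spectral_radius (map_mat complex_of_real (A + B * K)) < 1)"

text \<open>The block matrix with the blocks \<open>B, A B, \<dots>, A\<^sup>k\<^sup>-\<^sup>1 B\<close> side by side:
  column \<open>j\<close> belongs to block \<open>j div du\<close>.\<close>

definition controllability_mat :: "nat \<Rightarrow> nat \<Rightarrow> nat \<Rightarrow> real mat \<Rightarrow> real mat \<Rightarrow> real mat" where
  "controllability_mat dx du k A B =
     mat dx (k * du) (\<lambda>(i, j). (A ^\<^sub>m (j div du) * B) $$ (i, j mod du))"

definition strongly_controllable ::
    "nat \<Rightarrow> nat \<Rightarrow> nat \<Rightarrow> real \<Rightarrow> real mat \<Rightarrow> real mat \<Rightarrow> bool" where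
  "strongly_controllable dx du k \<kappa> A B \<longleftrightarrow>
     (let C = controllability_mat dx du k A B in
        vec_space.rank dx C = dx \<and>
        (\<exists>N. mat_inverse (C * transpose_mat C) = Some N \<and> spectral_norm N \<le> \<kappa>))"

section \<open>Costs\<close>

definition convex_cost :: "nat \<Rightarrow> nat \<Rightarrow> (real vec \<Rightarrow> real vec \<Rightarrow> real) \<Rightarrow> bool" where
  "convex_cost dx du c \<longleftrightarrow>
     (\<forall>x \<in> carrier_vec dx. \<forall>y \<in> carrier_vec dx. \<forall>u \<in> carrier_vec du. \<forall>v \<in> carrier_vec du.
        \<forall>l. 0 \<le> l \<and> l \<le> 1 \<longrightarrow>
          c (l \<cdot>\<^sub>v x + (1 - l) \<cdot>\<^sub>v y) (l \<cdot>\<^sub>v u + (1 - l) \<cdot>\<^sub>v v) \<le> l * c x u + (1 - l) * c y v)"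

text \<open>\<open>g\<close> is the gradient of \<open>c\<close> at \<open>(x, u)\<close> in the joint variable, in the sense of Frechet
  differentiability.\<close>

definition has_gradient ::
    "nat \<Rightarrow> nat \<Rightarrow> (real vec \<Rightarrow> real vec \<Rightarrow> real) \<Rightarrow> real vec \<Rightarrow> real vec \<Rightarrow> real vec \<Rightarrow> bool" where
  "has_gradient dx du c x u g \<longleftrightarrow>
     g \<in> carrier_vec (dx + du) \<and>
     (\<forall>\<epsilon>>0. \<exists>\<delta>>0. \<forall>h \<in> carrier_vec dx. \<forall>v \<in> carrier_vec du. vnorm (h @\<^sub>v v) < \<delta> \<longrightarrow>
        \<bar>c (x + h) (u + v) - c x u - g \<bullet> (h @\<^sub>v v)\<bar> \<le> \<epsilon> * vnorm (h @\<^sub>v v))"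

definition gradient_bound ::
    "nat \<Rightarrow> nat \<Rightarrow> real \<Rightarrow> (real vec \<Rightarrow> real vec \<Rightarrow> real) \<Rightarrow> bool" where
  "gradient_bound dx du G c \<longleftrightarrow>
     (\<forall>x \<in> carrier_vec dx. \<forall>u \<in> carrier_vec du. \<exists>g. has_gradient dx du c x u g \<and>
        (\<forall>D. vnorm x \<le> D \<and> vnorm u \<le> D \<longrightarrow> vnorm g \<le> G * D))"

definition instance_size :: "nat \<Rightarrow> nat \<Rightarrow> nat \<Rightarrow> real \<Rightarrow> real \<Rightarrow> real \<Rightarrow> real" where
  "instance_size k du dx G \<beta> \<kappa> = real k * real du + real dx + G + \<beta> + \<kappa>"

section \<open>Trajectories\<close>

text \<open>A policy computes \<open>u\<^sub>t\<close> from the list \<open>[x\<^sub>1, \<dots>, x\<^sub>t]\<close>, whose length is the current time.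
  Time starts at 1, so the values of perturbations and costs at index 0 are irrelevant.
  \<open>states A B w x1 \<pi> t\<close> is the list \<open>[x\<^sub>1, \<dots>, x\<^sub>t]\<close>.\<close>

type_synonym policy = "real vec list \<Rightarrow> real vec"

primrec states ::
    "real mat \<Rightarrow> real mat \<Rightarrow> (nat \<Rightarrow> real vec) \<Rightarrow> real vec \<Rightarrow> policy \<Rightarrow> nat \<Rightarrow> real vec list" where
  "states A B w x1 \<pi> 0 = []"
| "states A B w x1 \<pi> (Suc t) =
     (let xs = states A B w x1 \<pi> t in
        xs @ [if t = 0 then x1 else A *\<^sub>v last xs + B *\<^sub>v \<pi> xs + w t])"

definition total_cost ::
    "real mat \<Rightarrow> real mat \<Rightarrow> (nat \<Rightarrow> real vec) \<Rightarrow> (nat \<Rightarrow> real vec \<Rightarrow> real vec \<Rightarrow> real) \<Rightarrow>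
     real vec \<Rightarrow> nat \<Rightarrow> policy \<Rightarrow> real" where
  "total_cost A B w c x1 T \<pi> =
     (\<Sum>t = 1..T. let xs = states A B w x1 \<pi> t in c t (last xs) (\<pi> xs))"

section \<open>Black-box algorithms\<close>

text \<open>For control dimension \<open>du\<close>, observed states \<open>[x\<^sub>1, \<dots>, x\<^sub>t]\<close> and observed costs
  \<open>[c\<^sub>1, \<dots>, c\<^sub>t]\<close>, the algorithm outputs the control \<open>u\<^sub>t\<close>. It gets no access to the system
  matrices, but it has to know the dimension of the control it outputs.\<close>

type_synonym algorithm =
  "nat \<Rightarrow> real vec list \<Rightarrow> (real vec \<Rightarrow> real vec \<Rightarrow> real) list \<Rightarrow> real vec"

definition control_algorithm :: "nat \<Rightarrow> algorithm \<Rightarrow> bool" where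
  "control_algorithm dx alg \<longleftrightarrow>
     (\<forall>du xs cs. set xs \<subseteq> carrier_vec dx \<longrightarrow> alg du xs cs \<in> carrier_vec du)"

definition algorithm_policy ::
    "nat \<Rightarrow> algorithm \<Rightarrow> (nat \<Rightarrow> real vec \<Rightarrow> real vec \<Rightarrow> real) \<Rightarrow> policy" where
  "algorithm_policy du alg c xs = alg du xs (map c [1..<Suc (length xs)])"

section \<open>Disturbance-action controllers and regret\<close>

text \<open>The superscript of \<open>M\<^sup>i\<^sup>-\<^sup>1\<close> is an index, not a power: a controller has parameters
  \<open>K, M\<^sup>0, \<dots>, M\<^sup>H\<^sup>-\<^sup>1\<close>. Summands with \<open>t - i \<le> 0\<close> vanish by the convention \<open>w\<^sub>s = 0\<close>
  for \<open>s \<le> 0\<close>.\<close>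

definition dac_policy ::
    "nat \<Rightarrow> nat \<Rightarrow> (nat \<Rightarrow> real vec) \<Rightarrow> real mat \<Rightarrow> (nat \<Rightarrow> real mat) \<Rightarrow> policy" where
  "dac_policy du H w K M xs =
     (let t = length xs in
        K *\<^sub>v last xs +
        finsum_vec TYPE(real) du
          (\<lambda>i. if i < t then M (i - 1) *\<^sub>v w (t - i) else 0\<^sub>v du) {1..H})"

definition dac_class :: "nat \<Rightarrow> nat \<Rightarrow> nat \<Rightarrow> (nat \<Rightarrow> real vec) \<Rightarrow> policy set" where
  "dac_class dx du H w =
     {dac_policy du H w K M | K M.
        K \<in> carrier_mat du dx \<and> (\<forall>i<H. M i \<in> carrier_mat du dx)}"

text \<open>The infimum is a minimum when the comparator class contains a cost minimizer; statements
  about regret should assert this separately.\<close>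

definition regret ::
    "real mat \<Rightarrow> real mat \<Rightarrow> (nat \<Rightarrow> real vec) \<Rightarrow> (nat \<Rightarrow> real vec \<Rightarrow> real vec \<Rightarrow> real) \<Rightarrow>
     real vec \<Rightarrow> nat \<Rightarrow> policy set \<Rightarrow> policy \<Rightarrow> real" where
  "regret A B w c x1 T P \<pi> =
     total_cost A B w c x1 T \<pi> - (INF \<rho> \<in> P. total_cost A B w c x1 T \<rho>)"

end

theory Submission
  imports Defs
begin

text \<open>Take \<open>A = 2 I\<close>, zero perturbations and the cost \<open>\<parallel>x\<parallel>\<^sup>2\<close>, and allow \<open>d\<^sub>u = 2 d\<^sub>x\<close> controls. Feed
  the algorithm the uncontrolled trajectory \<open>x\<^sub>t = 2\<^sup>t\<^sup>-\<^sup>1 e\<^sub>1\<close>. It answers with fewer than \<open>d\<^sub>x\<close>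
  controls before time \<open>T = d\<^sub>x\<close>, so their orthogonal complement has room for \<open>d\<^sub>x\<close> orthonormal
  vectors. With these as the rows of \<open>B\<close> all those controls lie in the kernel of \<open>B\<close>, so the
  trajectory is indeed the uncontrolled one and the cost is at least \<open>4\<^bsup>T-1\<^esup>\<close>. On the
  other hand \<open>B B\<^sup>T = I\<close>, so \<open>K = - 2 B\<^sup>T\<close> moves the state to zero in one step, at total cost 1.\<close>

section \<open>Matrices with orthonormal rows\<close>

lemma scalar_prod_self_ge_0: "0 \<le> v \<bullet> (v :: real vec)"
  by (auto simp: scalar_prod_def intro!: sum_nonneg)

lemma vnorm_sq: "(vnorm v)\<^sup>2 = v \<bullet> v"
  by (simp add: vnorm_def scalar_prod_self_ge_0)

lemma vnorm_nonneg [simp]: "0 \<le> vnorm v"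
  by (simp add: vnorm_def scalar_prod_self_ge_0)

lemma vnorm_zero [simp]: "vnorm (0\<^sub>v n) = 0"
  by (simp add: vnorm_def)

lemma vnorm_smult: "vnorm (a \<cdot>\<^sub>v v) = \<bar>a\<bar> * vnorm v"
proof -
  have "(a \<cdot>\<^sub>v v) \<bullet> (a \<cdot>\<^sub>v v) = a\<^sup>2 * (v \<bullet> v)"
    by (simp add: power2_eq_square)
  then show ?thesis
    by (simp add: vnorm_def real_sqrt_mult)
qed

text \<open>Padding fewer than \<open>m\<close> vectors with zero rows gives a singular square
  matrix. A nonzero kernel vector is orthogonal to every row and only needs normalizing.\<close>

lemma exists_unit_vec_orthogonal:
  assumes "length vs < m" "set vs \<subseteq> carrier_vec m"
  shows "\<exists>b \<in> carrier_vec m. b \<bullet> b = (1::real) \<and> (\<forall>v \<in> set vs. b \<bullet> v = 0)"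
proof -
  define M where "M = mat\<^sub>r m m (\<lambda>i. if i < length vs then vs ! i else 0\<^sub>v m)"
  have M: "M \<in> carrier_mat m m"
    by (simp add: M_def)
  \<comment> \<open>Row \<open>length vs\<close> is already padding, as
    \<open>length vs < m\<close>; this form displays it as the zero row that
    \<open>det_row_0\<close> expects.\<close>
  have M': "M = mat\<^sub>r m m (\<lambda>i. if i = length vs then 0\<^sub>v m
      else if i < length vs then vs ! i else 0\<^sub>v m)"
    by (auto simp: M_def intro!: eq_matI)
  have "det M = 0"
    unfolding M'
    using assms by (intro det_row_0) (auto simp: subset_iff)
  then obtain v where v: "v \<in> carrier_vec m" "v \<noteq> 0\<^sub>v m" "M *\<^sub>v v = 0\<^sub>v m"
    using det_0_iff_vec_prod_zero_field[OF M] by blast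
  have orth: "w \<bullet> v = 0" if "w \<in> set vs" for w
  proof -
    from that obtain i where i: "i < length vs" "w = vs ! i"
      by (auto simp: in_set_conv_nth)
    have "row M i = w"
      using i assms that by (auto simp: M_def subset_iff)
    moreover have "(M *\<^sub>v v) $ i = row M i \<bullet> v"
      using i assms M by auto
    ultimately show ?thesis
      using v i assms by simp
  qed
  have pos: "v \<bullet> v > 0"
  proof -
    \<comment> \<open>Conjugation is trivial over the reals, so definiteness of the conjugate square
      applies.\<close>
    have "v \<bullet> v \<noteq> 0"
      using v conjugate_square_eq_0_vec[OF v(1)] by (simp add: conjugate_vec_def vec_eq_iff)
    then show ?thesis
      using scalar_prod_self_ge_0[of v] by linarith
  qed
  define b where "b = (1 / sqrt (v \<bullet> v)) \<cdot>\<^sub>v v"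
  have "b \<bullet> b = (1 / sqrt (v \<bullet> v))\<^sup>2 * (v \<bullet> v)"
    by (simp add: b_def power2_eq_square)
  then have "b \<bullet> b = 1"
    using pos by (simp add: power_divide)
  moreover have "b \<bullet> w = 0" if "w \<in> set vs" for w
    using orth[OF that] that v assms comm_scalar_prod[of w m v] by (auto simp: b_def subset_iff)
  ultimately show ?thesis
    using v(1) by (intro bexI[of _ b]) (auto simp: b_def)
qed

text \<open>The vectors are added one at a time, each orthogonal to \<open>vs\<close> and to those
  already chosen; the dimension bound leaves room at every step.\<close>

lemma exists_orthonormal_orthogonal:
  assumes "length vs + n \<le> m" "set vs \<subseteq> carrier_vec m"
  shows "\<exists>bs. length bs = n \<and> set bs \<subseteq> carrier_vec m \<and>
    (\<forall>i<n. \<forall>j<n. bs ! i \<bullet> bs ! j = (if i = j then 1 else 0 :: real)) \<and>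
    (\<forall>b \<in> set bs. \<forall>v \<in> set vs. b \<bullet> v = 0)"
  using assms(1)
proof (induction n)
  case (Suc n)
  then obtain bs where bs: "length bs = n" "set bs \<subseteq> carrier_vec m"
    "\<And>i j. i < n \<Longrightarrow> j < n \<Longrightarrow> bs ! i \<bullet> bs ! j = (if i = j then 1 else 0 :: real)"
    "\<And>b v. b \<in> set bs \<Longrightarrow> v \<in> set vs \<Longrightarrow> b \<bullet> v = 0"
    by auto
  obtain b where b: "b \<in> carrier_vec m" "b \<bullet> b = 1" "\<And>v. v \<in> set (vs @ bs) \<Longrightarrow> b \<bullet> v = 0"
    using exists_unit_vec_orthogonal[of "vs @ bs" m] Suc.prems assms(2) bs(1,2) by auto
  have "b \<bullet> bs ! i = 0" "bs ! i \<bullet> b = 0" if "i < n" for i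
  proof -
    have i: "bs ! i \<in> set bs" using that bs(1) by simp
    then show "b \<bullet> bs ! i = 0" using b(3) by simp
    then show "bs ! i \<bullet> b = 0" using i bs(2) b(1) comm_scalar_prod by (metis subsetD)
  qed
  then show ?case
    using bs b by (intro exI[of _ "bs @ [b]"]) (auto simp: nth_append less_Suc_eq)
qed simp

text \<open>Orthonormal vectors orthogonal to \<open>vs\<close> become the rows of \<open>B\<close>:
  both claims are then inner products with these rows, read entrywise.\<close>

lemma exists_coisometry_killing:
  assumes "length vs + n \<le> m" "set vs \<subseteq> carrier_vec m"
  shows "\<exists>B \<in> carrier_mat n m. B * transpose_mat B = (1\<^sub>m n :: real mat) \<and>
    (\<forall>v \<in> set vs. B *\<^sub>v v = 0\<^sub>v n)"
proof -
  obtain bs where bs: "length bs = n" "set bs \<subseteq> carrier_vec m"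
    "\<And>i j. i < n \<Longrightarrow> j < n \<Longrightarrow> bs ! i \<bullet> bs ! j = (if i = j then 1 else 0 :: real)"
    "\<And>b v. b \<in> set bs \<Longrightarrow> v \<in> set vs \<Longrightarrow> b \<bullet> v = 0"
    using exists_orthonormal_orthogonal[OF assms] by auto
  define B where "B = mat_of_rows m bs"
  have B: "B \<in> carrier_mat n m"
    using bs(1) by (auto simp: B_def)
  have row: "row B i = bs ! i" if "i < n" for i
    using that bs(1,2) by (auto simp: B_def subset_iff intro!: mat_of_rows_row)
  have "B * transpose_mat B = 1\<^sub>m n"
    using B row bs(3) by (intro eq_matI) auto
  moreover have "B *\<^sub>v v = 0\<^sub>v n" if "v \<in> set vs" for v
    using B row bs(1,4) that by (intro eq_vecI) auto
  ultimately show ?thesis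
    using B by blast
qed

section \<open>Norm, rank and controllability when \<open>B * transpose_mat B\<close> is the
  identity\<close>

lemma coisometry_mult_transpose_vec:
  assumes "B \<in> carrier_mat n m" "B * transpose_mat B = (1\<^sub>m n :: 'a :: field mat)" "y \<in> carrier_vec n"
  shows "B *\<^sub>v (transpose_mat B *\<^sub>v y) = y"
  using assms assoc_mult_mat_vec[of B n m "transpose_mat B" n y] by simp

text \<open>The vector \<open>z\<close> is the orthogonal projection of \<open>v\<close> onto the
  row space of \<open>B\<close> and has the norm of \<open>B *\<^sub>v v\<close>; Pythagoras gives
  the bound.\<close>

lemma vnorm_coisometry_le:
  assumes B: "B \<in> carrier_mat n m" "B * transpose_mat B = 1\<^sub>m n" and v: "v \<in> carrier_vec m"
  shows "vnorm (B *\<^sub>v v) \<le> vnorm v"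
proof -
  define y where "y = B *\<^sub>v v"
  define z where "z = transpose_mat B *\<^sub>v y"
  have y: "y \<in> carrier_vec n" and z: "z \<in> carrier_vec m"
    using B v by (auto simp: y_def z_def)
  have Bz: "B *\<^sub>v z = y"
    unfolding z_def by (rule coisometry_mult_transpose_vec[OF B y])
  have zv: "z \<bullet> v = y \<bullet> y"
    unfolding z_def using transpose_vec_mult_scalar[OF B(1) v y] by (simp add: y_def)
  have zz: "z \<bullet> z = y \<bullet> y"
    using transpose_vec_mult_scalar[OF B(1) z y] Bz by (simp add: z_def)
  have "0 \<le> (v - z) \<bullet> (v - z)"
    by (rule scalar_prod_self_ge_0)
  also have "\<dots> = v \<bullet> v - y \<bullet> y"
    using v z zv zz comm_scalar_prod[OF v z]
    by (simp add: minus_scalar_prod_distrib[of _ m] scalar_prod_minus_distrib[of _ m])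
  finally show ?thesis
    by (simp add: vnorm_def y_def)
qed

lemma spectral_norm_le:
  assumes "\<And>v. v \<in> carrier_vec (dim_col M) \<Longrightarrow> vnorm v \<le> 1 \<Longrightarrow> vnorm (M *\<^sub>v v) \<le> b"
  shows "spectral_norm M \<le> b"
  unfolding spectral_norm_def
proof (rule cSUP_least)
  have "0\<^sub>v (dim_col M) \<in> {v \<in> carrier_vec (dim_col M). vnorm v \<le> 1}"
    by simp
  then show "{v \<in> carrier_vec (dim_col M). vnorm v \<le> 1} \<noteq> {}"
    by blast
qed (use assms in auto)

text \<open>The transpose is a right inverse, so \<open>B\<close> is onto and its column space is
  everything.\<close>

lemma rank_coisometry:
  assumes B: "B \<in> carrier_mat n m" "B * transpose_mat B = (1\<^sub>m n :: 'a :: field mat)"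
  shows "vec_space.rank n B = n"
proof -
  interpret vec_space "TYPE('a)" n .
  have "y \<in> col_space B" if y: "y \<in> carrier_vec n" for y
  proof -
    have "B *\<^sub>v (transpose_mat B *\<^sub>v y) = y"
      by (rule coisometry_mult_transpose_vec[OF B y])
    then show ?thesis
      using B y by (auto simp: col_space_eq[OF B(1)] intro!: bexI[of _ "transpose_mat B *\<^sub>v y"])
  qed
  then have "col_space B = carrier_vec n"
    using B by (auto simp: col_space_eq[OF B(1)])
  then have "span_vs (set (cols B)) = V"
    by (simp add: col_space_def module_vec_def)
  then show ?thesis
    by (simp add: rank_def dim_is_n)
qed

lemma controllability_mat_one:
  assumes "A \<in> carrier_mat n n" "B \<in> carrier_mat n m"
  shows "controllability_mat n m 1 A B = B"
  using assms by (intro eq_matI) (auto simp: controllability_mat_def)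

text \<open>For \<open>k = 1\<close> the controllability matrix is \<open>B\<close> itself, whatever
  \<open>A\<close> is. Its Gram matrix is the identity, which is its own inverse and has norm at
  most 1; hence \<open>\<kappa> = 1\<close>.\<close>

lemma strongly_controllable_coisometry:
  assumes A: "A \<in> carrier_mat n n" and B: "B \<in> carrier_mat n m" "B * transpose_mat B = 1\<^sub>m n"
  shows "strongly_controllable n m 1 1 A B"
proof -
  have "\<exists>N. mat_inverse (1\<^sub>m n :: real mat) = Some N \<and> spectral_norm N \<le> 1"
  proof (cases "mat_inverse (1\<^sub>m n :: real mat)")
    case None
    \<comment> \<open>A failed inversion would say that the identity is not a unit of the matrix
      ring.\<close>
    from mat_inverse(1)[OF one_carrier_mat this, of "()"] have False
      by (auto simp: Units_def ring_mat_def)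
    then show ?thesis ..
  next
    case (Some N)
    then have "N = 1\<^sub>m n"
      using mat_inverse(2)[OF one_carrier_mat Some] by auto
    then show ?thesis
      using Some by (auto intro!: spectral_norm_le)
  qed
  then show ?thesis
    unfolding strongly_controllable_def controllability_mat_one[OF A B(1)] Let_def
    using rank_coisometry[OF B] B(2) by simp
qed

lemma spectral_radius_zero_mat:
  assumes "n > 0"
  shows "spectral_radius (0\<^sub>m n n) = 0"
proof -
  have "spectral_radius (0\<^sub>m n n) \<in> norm ` spectrum (0\<^sub>m n n :: complex mat)"
    by (rule spectral_radius_mem_max(1)[OF _ assms]) simp
  then obtain k where k: "eigenvalue (0\<^sub>m n n :: complex mat) k" "spectral_radius (0\<^sub>m n n) = norm k"
    by (auto simp: spectrum_def)
  then obtain v where v: "v \<in> carrier_vec n" "v \<noteq> 0\<^sub>v n" "0\<^sub>m n n *\<^sub>v v = k \<cdot>\<^sub>v v"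
    by (auto simp: eigenvalue_def eigenvector_def)
  have "k = 0"
  proof (rule ccontr)
    assume "k \<noteq> 0"
    then have "v $ i = 0" if "i < n" for i
      using arg_cong[OF v(3), of "\<lambda>x. x $ i"] that v(1) by simp
    then show False
      using v(1,2) by (auto simp: vec_eq_iff)
  qed
  then show ?thesis
    using k by simp
qed

section \<open>The quadratic state cost\<close>

text \<open>The gap between the two sides is exactly
  \<open>l * (1 - l) * (a - b)\<^sup>2\<close>.\<close>

lemma convex_square:
  fixes a b l :: real
  assumes "0 \<le> l" "l \<le> 1"
  shows "(l * a + (1 - l) * b) * (l * a + (1 - l) * b) \<le> l * (a * a) + (1 - l) * (b * b)"
proof -
  have "0 \<le> l * (1 - l) * (a - b)\<^sup>2"
    using assms by simp
  also have "\<dots> = l * (a * a) + (1 - l) * (b * b) - (l * a + (1 - l) * b) * (l * a + (1 - l) * b)"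
    by (simp add: power2_eq_square algebra_simps)
  finally show ?thesis
    by simp
qed

lemma convex_cost_sq: "convex_cost n m (\<lambda>x u. x \<bullet> x)"
  unfolding convex_cost_def
proof (intro ballI allI impI)
  fix x y :: "real vec" and l :: real
  assume *: "x \<in> carrier_vec n" "y \<in> carrier_vec n" "0 \<le> l \<and> l \<le> 1"
  let ?z = "l \<cdot>\<^sub>v x + (1 - l) \<cdot>\<^sub>v y"
  have "?z \<bullet> ?z = (\<Sum>i<n. (l * x $ i + (1 - l) * y $ i) * (l * x $ i + (1 - l) * y $ i))"
    using * by (simp add: scalar_prod_def lessThan_atLeast0)
  also have "\<dots> \<le> (\<Sum>i<n. l * (x $ i * x $ i) + (1 - l) * (y $ i * y $ i))"
    using * by (intro sum_mono convex_square) auto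
  also have "\<dots> = l * (x \<bullet> x) + (1 - l) * (y \<bullet> y)"
    using * by (simp only: sum.distrib sum_distrib_left scalar_prod_def lessThan_atLeast0 carrier_vecD)
  finally show "?z \<bullet> ?z \<le> l * (x \<bullet> x) + (1 - l) * (y \<bullet> y)" .
qed

text \<open>The gradient is \<open>2 x\<close> in the state and zero in the control, of norm
  \<open>2 * vnorm x\<close>. The first-order remainder is exactly \<open>h \<bullet> h\<close>, at
  most the squared norm of the joint increment, so \<open>\<delta> = \<epsilon>\<close>
  works.\<close>

lemma gradient_bound_sq: "gradient_bound n m 2 (\<lambda>x u. x \<bullet> x)"
  unfolding gradient_bound_def
proof (intro ballI)
  fix x u :: "real vec"
  assume x: "x \<in> carrier_vec n" and u: "u \<in> carrier_vec m"
  let ?g = "(2 \<cdot>\<^sub>v x) @\<^sub>v 0\<^sub>v m"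
  have "has_gradient n m (\<lambda>x u. x \<bullet> x) x u ?g"
    unfolding has_gradient_def
  proof (intro conjI allI impI)
    show "?g \<in> carrier_vec (n + m)"
      using x by simp
    fix e :: real
    assume e: "0 < e"
    have "\<bar>(x + h) \<bullet> (x + h) - x \<bullet> x - ?g \<bullet> (h @\<^sub>v v)\<bar> \<le> e * vnorm (h @\<^sub>v v)"
      if h: "h \<in> carrier_vec n" and v: "v \<in> carrier_vec m" and small: "vnorm (h @\<^sub>v v) < e" for h v
    proof -
      have "(x + h) \<bullet> (x + h) - x \<bullet> x - ?g \<bullet> (h @\<^sub>v v) = h \<bullet> h"
        using x h v comm_scalar_prod[OF x h]
        by (simp add: scalar_prod_append[of _ n _ m] add_scalar_prod_distrib[of _ n]
            scalar_prod_add_distrib[of _ n])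
      then have "\<bar>(x + h) \<bullet> (x + h) - x \<bullet> x - ?g \<bullet> (h @\<^sub>v v)\<bar> = h \<bullet> h"
        using scalar_prod_self_ge_0[of h] by simp
      also have "\<dots> \<le> h \<bullet> h + v \<bullet> v"
        using scalar_prod_self_ge_0[of v] by simp
      also have "\<dots> = (vnorm (h @\<^sub>v v))\<^sup>2"
        using h v by (simp add: vnorm_sq scalar_prod_append[of _ n _ m])
      also have "\<dots> \<le> e * vnorm (h @\<^sub>v v)"
        using small by (simp add: power2_eq_square mult_right_mono)
      finally show ?thesis .
    qed
    then show "\<exists>\<delta>>0. \<forall>h\<in>carrier_vec n. \<forall>v\<in>carrier_vec m. vnorm (h @\<^sub>v v) < \<delta> \<longrightarrow>
        \<bar>(x + h) \<bullet> (x + h) - x \<bullet> x - ?g \<bullet> (h @\<^sub>v v)\<bar> \<le> e * vnorm (h @\<^sub>v v)"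
      using e by blast
  qed
  moreover have "vnorm ?g = 2 * vnorm x"
  proof -
    have "vnorm ?g = vnorm (2 \<cdot>\<^sub>v x)"
      using x by (simp add: vnorm_def scalar_prod_append[of _ n _ m])
    then show ?thesis
      by (simp add: vnorm_smult)
  qed
  ultimately show "\<exists>g. has_gradient n m (\<lambda>x u. x \<bullet> x) x u g \<and>
      (\<forall>D. vnorm x \<le> D \<and> vnorm u \<le> D \<longrightarrow> vnorm g \<le> 2 * D)"
    by (intro exI[of _ ?g]) auto
qed

section \<open>Trajectories of the doubling system\<close>

text \<open>The hypothesis \<open>kills\<close> concerns the answers of \<open>\<pi>\<close> on the
  predicted trajectory, not on the actual one. This avoids circularity when \<open>B\<close> is
  chosen from those answers; induction shows that the two trajectories agree. Only times before
  \<open>T\<close> matter, since the control at \<open>T\<close> affects later states only.\<close>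

lemma states_uncontrolled:
  assumes B: "B \<in> carrier_mat n m"
    and x1: "x1 \<in> carrier_vec n"
    and kills: "\<And>t. 0 < t \<Longrightarrow> t < T \<Longrightarrow> B *\<^sub>v \<pi> (map (\<lambda>i. 2 ^ i \<cdot>\<^sub>v x1) [0..<t]) = 0\<^sub>v n"
    and "t \<le> T"
  shows "states (2 \<cdot>\<^sub>m 1\<^sub>m n) B (\<lambda>_. 0\<^sub>v n) x1 \<pi> t = map (\<lambda>i. 2 ^ i \<cdot>\<^sub>v x1) [0..<t]"
  using \<open>t \<le> T\<close>
proof (induction t)
  case (Suc t)
  show ?case
  proof (cases "t = 0")
    case False
    then obtain s where t: "t = Suc s"
      by (cases t) auto
    have "last (map (\<lambda>i. 2 ^ i \<cdot>\<^sub>v x1) [0..<t]) = 2 ^ s \<cdot>\<^sub>v x1"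
      by (simp add: t)
    moreover have "(2 \<cdot>\<^sub>m 1\<^sub>m n) *\<^sub>v (2 ^ s \<cdot>\<^sub>v x1) = 2 ^ t \<cdot>\<^sub>v x1"
      using x1 by (intro eq_vecI) (auto simp: t)
    ultimately show ?thesis
      using Suc kills[of t] x1 False by (simp add: Let_def del: last_map)
  qed (use x1 in simp)
qed simp

lemma dac_policy_zero_disturbance:
  assumes "K \<in> carrier_mat m n" "last xs \<in> carrier_vec n"
  shows "dac_policy m H (\<lambda>_. 0\<^sub>v n) K (\<lambda>_. 0\<^sub>m m n) xs = K *\<^sub>v last xs"
proof -
  have zero: "(\<lambda>i. if i < length xs then 0\<^sub>m m n *\<^sub>v 0\<^sub>v n else 0\<^sub>v m) = (\<lambda>i. 0\<^sub>v m :: real vec)"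
    by (auto intro!: eq_vecI)
  have closed: "finsum_vec TYPE(real) m (\<lambda>i. 0\<^sub>v m) {1..H} \<in> carrier_vec m"
    by (rule finsum_vec_closed) simp
  have "finsum_vec TYPE(real) m (\<lambda>i. 0\<^sub>v m) {1..H} = 0\<^sub>v m"
    by (rule eq_vecI) (use closed in \<open>auto simp: index_finsum_vec\<close>)
  then show ?thesis
    using assms by (simp add: dac_policy_def Let_def zero)
qed

text \<open>The closed-loop matrix is \<open>2 I - 2 B B^T = 0\<close>, so only the initial state is
  nonzero.\<close>

lemma states_deadbeat:
  assumes B: "B \<in> carrier_mat n m" "B * transpose_mat B = 1\<^sub>m n"
    and x1: "x1 \<in> carrier_vec n"
    and \<pi>: "\<And>xs. last xs \<in> carrier_vec n \<Longrightarrow> \<pi> xs = ((-2) \<cdot>\<^sub>m transpose_mat B) *\<^sub>v last xs"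
    and "0 < t"
  shows "last (states (2 \<cdot>\<^sub>m 1\<^sub>m n) B (\<lambda>_. 0\<^sub>v n) x1 \<pi> t) = (if t = 1 then x1 else 0\<^sub>v n)"
  using \<open>0 < t\<close>
proof (induction t)
  case (Suc t)
  have step: "(2 \<cdot>\<^sub>m 1\<^sub>m n) *\<^sub>v y + B *\<^sub>v (((-2) \<cdot>\<^sub>m transpose_mat B) *\<^sub>v y) = 0\<^sub>v n"
    if y: "y \<in> carrier_vec n" for y
  proof -
    have "B *\<^sub>v (((-2) \<cdot>\<^sub>m transpose_mat B) *\<^sub>v y) = (B * ((-2) \<cdot>\<^sub>m transpose_mat B)) *\<^sub>v y"
      using B y by (intro assoc_mult_mat_vec[symmetric]) auto
    also have "B * ((-2) \<cdot>\<^sub>m transpose_mat B) = (-2) \<cdot>\<^sub>m 1\<^sub>m n"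
      using B mult_smult_distrib[of B n m "transpose_mat B" n "-2"] by simp
    finally show ?thesis
      using y by (intro eq_vecI) auto
  qed
  show ?case
  proof (cases "t = 0")
    case False
    let ?xs = "states (2 \<cdot>\<^sub>m 1\<^sub>m n) B (\<lambda>_. 0\<^sub>v n) x1 \<pi> t"
    have "last ?xs \<in> carrier_vec n"
      using Suc False x1 by simp
    then show ?thesis
      using False step[of "last ?xs"] \<pi>[of ?xs] by (simp add: Let_def)
  qed simp
qed simp

text \<open>No policy influences the first state, so its cost is unavoidable. This makes the
  deadbeat controller optimal.\<close>

lemma total_cost_sq_ge_initial:
  assumes "0 < T"
  shows "x1 \<bullet> x1 \<le> total_cost A B w (\<lambda>_ x u. x \<bullet> x) x1 T \<pi>"
proof -
  have "x1 \<bullet> x1 = (\<Sum>t\<in>{1::nat}. last (states A B w x1 \<pi> t) \<bullet> last (states A B w x1 \<pi> t))"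
    by simp
  also have "\<dots> \<le> (\<Sum>t = 1..T. last (states A B w x1 \<pi> t) \<bullet> last (states A B w x1 \<pi> t))"
    using assms by (intro sum_mono2) (auto simp: scalar_prod_self_ge_0)
  finally show ?thesis
    by (simp add: total_cost_def Let_def)
qed

section \<open>The hard instance and its regret\<close>

theorem theorem21:
  shows "\<exists>c>0::real. \<exists>d0::nat. \<forall>dx\<ge>d0. \<forall>H::nat. \<forall>alg. control_algorithm dx alg \<longrightarrow>
    (\<exists>du A B w cost \<beta> G.
       A \<in> carrier_mat dx dx \<and> B \<in> carrier_mat dx du \<and>
       stabilizable dx du A B \<and>
       strongly_controllable dx du 1 1 A B \<and>
       1 \<le> \<beta> \<and> spectral_norm A \<le> \<beta> \<and> spectral_norm B \<le> \<beta> \<and>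
       (\<forall>t\<ge>1. w t \<in> carrier_vec dx \<and> vnorm (w t) \<le> 1) \<and>
       (\<forall>t\<ge>1. convex_cost dx du (cost t) \<and> gradient_bound dx du G (cost t)) \<and>
       (\<exists>\<rho>. is_arg_min (total_cost A B w cost (unit_vec dx 0) dx)
              (\<lambda>\<rho>. \<rho> \<in> dac_class dx du H w) \<rho>) \<and>
       regret A B w cost (unit_vec dx 0) dx (dac_class dx du H w) (algorithm_policy du alg cost)
         \<ge> 2 powr (c * instance_size 1 du dx G \<beta> 1))"
proof (rule exI[of _ "1/4 :: real"], rule conjI[rotated], rule exI[of _ "3 :: nat"], intro allI impI)
  fix dx H :: nat and alg :: algorithm
  assume dx: "3 \<le> dx" and alg: "control_algorithm dx alg"
  \<comment> \<open>Room for \<open>dx - 1\<close> controls to be killed and \<open>dx\<close>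
    orthonormal rows, while the size stays linear in \<open>dx\<close>.\<close>
  define du where "du = 2 * dx"
  define e :: "real vec" where "e = unit_vec dx 0"
  define cost :: "nat \<Rightarrow> real vec \<Rightarrow> real vec \<Rightarrow> real" where "cost = (\<lambda>_ x u. x \<bullet> x)"
  define A :: "real mat" where "A = 2 \<cdot>\<^sub>m 1\<^sub>m dx"
  define w :: "nat \<Rightarrow> real vec" where "w = (\<lambda>_. 0\<^sub>v dx)"
  define \<pi> where "\<pi> = algorithm_policy du alg cost"
  define X where "X = (\<lambda>t. map (\<lambda>i. 2 ^ i \<cdot>\<^sub>v e) [0..<t])"
  \<comment> \<open>These answers are determined before \<open>B\<close> exists: the algorithm sees
    only \<open>du\<close>, states and costs.\<close>
  define us where "us = map (\<lambda>t. \<pi> (X t)) [1..<dx]"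
  have e: "e \<in> carrier_vec dx" "e \<bullet> e = 1"
    using dx by (auto simp: e_def)
  have "set (X t) \<subseteq> carrier_vec dx" for t
    using e(1) by (auto simp: X_def)
  then have "\<pi> (X t) \<in> carrier_vec du" for t
    using alg unfolding control_algorithm_def \<pi>_def algorithm_policy_def by blast
  then have us: "length us + dx \<le> du" "set us \<subseteq> carrier_vec du"
    by (auto simp: us_def du_def)
  obtain B where B: "B \<in> carrier_mat dx du" "B * transpose_mat B = 1\<^sub>m dx"
    and kills: "\<And>u. u \<in> set us \<Longrightarrow> B *\<^sub>v u = 0\<^sub>v dx"
    using exists_coisometry_killing[OF us] by blast
  have A: "A \<in> carrier_mat dx dx"
    by (simp add: A_def)
  define K where "K = (-2) \<cdot>\<^sub>m transpose_mat B"
  have K: "K \<in> carrier_mat du dx"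
    using B by (simp add: K_def)

  have "A + B * K = 0\<^sub>m dx dx"
  proof -
    have "B * K = (-2) \<cdot>\<^sub>m 1\<^sub>m dx"
      using B mult_smult_distrib[of B dx du "transpose_mat B" dx "-2"] by (simp add: K_def)
    then show ?thesis
      by (intro eq_matI) (auto simp: A_def)
  qed
  moreover have "map_mat complex_of_real (0\<^sub>m dx dx) = 0\<^sub>m dx dx"
    by (intro eq_matI) auto
  ultimately have stab: "stabilizable dx du A B"
    unfolding stabilizable_def using K dx by (intro bexI[of _ K]) (auto simp: spectral_radius_zero_mat)

  \<comment> \<open>\<open>A\<close> doubles norms and \<open>B\<close> does not increase them, so
    \<open>\<beta> = 2\<close> serves both.\<close>
  have normA: "spectral_norm A \<le> 2"
  proof (rule spectral_norm_le)
    fix v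
    assume v: "v \<in> carrier_vec (dim_col A)" "vnorm v \<le> 1"
    have "A *\<^sub>v v = 2 \<cdot>\<^sub>v v"
      using v by (intro eq_vecI) (auto simp: A_def)
    then show "vnorm (A *\<^sub>v v) \<le> 2"
      using v by (simp add: vnorm_smult)
  qed
  have normB: "spectral_norm B \<le> 2"
    by (rule spectral_norm_le) (use vnorm_coisometry_le[OF B] B in fastforce)

  define J where "J = total_cost A B w cost e dx"
  \<comment> \<open>The deadbeat feedback, with all disturbance parameters zero, lies in the class
    for every \<open>H\<close>.\<close>
  define \<rho> where "\<rho> = dac_policy du H w K (\<lambda>_. 0\<^sub>m du dx)"
  have \<rho>: "\<rho> \<in> dac_class dx du H w"
    using K unfolding \<rho>_def dac_class_def by (auto intro!: exI[of _ K] exI[of _ "\<lambda>_. 0\<^sub>m du dx"])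
  have J_ge: "1 \<le> J \<sigma>" for \<sigma>
    using total_cost_sq_ge_initial[of dx e A B w \<sigma>] dx e(2) by (simp add: J_def cost_def)
  have "J \<rho> = (\<Sum>t = 1..dx. if t = 1 then 1 else 0)"
    unfolding J_def total_cost_def Let_def cost_def
  proof (rule sum.cong[OF refl])
    fix t
    assume t: "t \<in> {1..dx}"
    have "\<rho> xs = ((-2) \<cdot>\<^sub>m transpose_mat B) *\<^sub>v last xs" if "last xs \<in> carrier_vec dx" for xs
      using dac_policy_zero_disturbance[OF K that] by (simp add: \<rho>_def w_def K_def)
    then show "last (states A B w e \<rho> t) \<bullet> last (states A B w e \<rho> t) = (if t = 1 then 1 else 0)"
      using states_deadbeat[OF B e(1), of \<rho> t] t e(2) by (simp add: A_def w_def)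
  qed
  also have "\<dots> = 1"
    using dx by simp
  finally have J_\<rho>: "J \<rho> = 1" .

  \<comment> \<open>Only the first and last summands are kept; the first, equal to 1, cancels the
    cost of \<open>\<rho>\<close> in the regret.\<close>
  have "2 ^ (2 * (dx - 1)) + 1 \<le> J \<pi>"
  proof -
    have "last (states A B w e \<pi> t) \<bullet> last (states A B w e \<pi> t) = 2 ^ (2 * (t - 1))"
      if t: "t \<in> {1..dx}" for t
    proof -
      have "states A B w e \<pi> t = map (\<lambda>i. 2 ^ i \<cdot>\<^sub>v e) [0..<t]"
        unfolding A_def w_def
        by (rule states_uncontrolled[OF B(1) e(1), of dx])
          (use t kills in \<open>auto simp: us_def X_def\<close>)
      then have "last (states A B w e \<pi> t) = 2 ^ (t - 1) \<cdot>\<^sub>v e"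
        using t by (simp add: last_map)
      then show ?thesis
        using e by (simp add: mult_2 power_add)
    qed
    then have "J \<pi> = (\<Sum>t = 1..dx. 2 ^ (2 * (t - 1)))"
      unfolding J_def total_cost_def Let_def cost_def by (intro sum.cong) auto
    also have "\<dots> \<ge> (\<Sum>t \<in> {1, dx}. 2 ^ (2 * (t - 1)))"
      using dx by (intro sum_mono2) auto
    finally show ?thesis
      using dx by simp
  qed
  moreover have "(INF \<sigma> \<in> dac_class dx du H w. J \<sigma>) = J \<rho>"
    using \<rho> J_ge J_\<rho> by (intro cInf_eq_minimum) auto
  ultimately have reg0: "regret A B w cost e dx (dac_class dx du H w) \<pi> \<ge> 2 ^ (2 * (dx - 1))"
    using J_\<rho> by (simp add: regret_def J_def)
  \<comment> \<open>The size is \<open>2 dx + dx + 2 + 2 + 1 = 3 dx + 5\<close>. A quarter of it is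
    at most \<open>2 dx - 2\<close> once \<open>5 dx \<ge> 13\<close>, which explains the threshold
    3.\<close>
  have "2 powr (1/4 * instance_size 1 du dx 2 2 1) \<le> 2 powr real (2 * (dx - 1))"
    using dx by (intro powr_mono) (auto simp: instance_size_def du_def)
  then have "2 powr (1/4 * instance_size 1 du dx 2 2 1) \<le> 2 ^ (2 * (dx - 1))"
    by (subst (asm) powr_realpow) simp_all
  with reg0 have reg: "2 powr (1/4 * instance_size 1 du dx 2 2 1)
      \<le> regret A B w cost e dx (dac_class dx du H w) \<pi>"
    by linarith

  \<comment> \<open>The infimum in the regret is attained at \<open>\<rho>\<close>, so it is a
    genuine minimum.\<close>
  have "is_arg_min J (\<lambda>\<sigma>. \<sigma> \<in> dac_class dx du H w) \<rho>"
    using \<rho> J_ge J_\<rho> by (auto simp: is_arg_min_def not_less)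
  then have min: "\<exists>\<rho>. is_arg_min (total_cost A B w cost e dx) (\<lambda>\<sigma>. \<sigma> \<in> dac_class dx du H w) \<rho>"
    unfolding J_def by blast
  have dist: "\<forall>t\<ge>1. w t \<in> carrier_vec dx \<and> vnorm (w t) \<le> 1"
    by (simp add: w_def)
  have costs: "\<forall>t\<ge>1. convex_cost dx du (cost t) \<and> gradient_bound dx du 2 (cost t)"
    by (simp add: cost_def convex_cost_sq gradient_bound_sq)
  show "\<exists>du A B w cost \<beta> G.
       A \<in> carrier_mat dx dx \<and> B \<in> carrier_mat dx du \<and>
       stabilizable dx du A B \<and>
       strongly_controllable dx du 1 1 A B \<and>
       1 \<le> \<beta> \<and> spectral_norm A \<le> \<beta> \<and> spectral_norm B \<le> \<beta> \<and>
       (\<forall>t\<ge>1. w t \<in> carrier_vec dx \<and> vnorm (w t) \<le> 1) \<and>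
       (\<forall>t\<ge>1. convex_cost dx du (cost t) \<and> gradient_bound dx du G (cost t)) \<and>
       (\<exists>\<rho>. is_arg_min (total_cost A B w cost (unit_vec dx 0) dx)
              (\<lambda>\<rho>. \<rho> \<in> dac_class dx du H w) \<rho>) \<and>
       regret A B w cost (unit_vec dx 0) dx (dac_class dx du H w) (algorithm_policy du alg cost)
         \<ge> 2 powr (1/4 * instance_size 1 du dx G \<beta> 1)"
    by (rule exI[of _ du], rule exI[of _ A], rule exI[of _ B], rule exI[of _ w],
        rule exI[of _ cost], rule exI[of _ "2 :: real"], rule exI[of _ "2 :: real"])
      (use A B(1) stab strongly_controllable_coisometry[OF A B] normA normB dist costs
        min[unfolded e_def] reg[unfolded e_def \<pi>_def] in simp)
qed simp

end
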